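(* Let $n\ge 1$ and let $\mathscr{C}_i=E_i|H_i$, $i=1,\ldots,n+1$, be $n+1$ conditional events, with all previsions involved coherently assessed. Then for every $1\le h\le n$ and every (possibly empty) subset $\{i_1,\ldots,i_k\}\subseteq\{h+1,\ldots,n\}$ the following distributivity property holds: \[ \begin{aligned} &\Big[1-\sum_{i=1}^h\mathscr{C}_i+\sum_{1\le j_1<j_2\le h}\mathscr{C}_{j_1j_2}+\cdots+(-1)^h\mathscr{C}_{1\cdots h}\Big]\wedge\mathscr{C}_{i_1\cdots i_k\,n+1}\\ &=1\wedge\mathscr{C}_{i_1\cdots i_k\,n+1}-\sum_{i=1}^h\mathscr{C}_i\wedge\mathscr{C}_{i_1\cdots i_k\,n+1}+\sum_{1\le j_1<j_2\le h}\mathscr{C}_{j_1j_2}\wedge\mathscr{C}_{i_1\cdots i_k\,n+1}+\cdots+(-1)^h\mathscr{C}_{1\cdots h}\wedge\mathscr{C}_{i_1\cdots i_k\,n+1}. \end{aligned} \] Here the bracketed quantity denotes the conjunction $\mathscr{C}_{\overline{1}\cdots\overline{h}}=\bigwedge_{i=1}^h(\overline{E}_i|H_i)$, with which it coincides, so that the left-hand side is $\mathscr{C}_{\overline{1}\cdots\overline{h}}\wedge\mathscr{C}_{i_1\cdots i_k\,n+1}$.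
   Context: Events. Events are elements of a Boolean algebra with top $\Omega$ (sure event) and bottom $\emptyset$ (impossible event); one may take subsets of a set $\Omega$. An event is identified with its $0/1$ indicator; $EF$ or $E\wedge F$ is conjunction, $E\vee F$ disjunction, $\overline{E}$ negation. Conditional random quantities. Given an event $H\neq\emptyset$, a random quantity $X$ (a real-valued function on $\Omega$ with finitely many values on $H$) and an assessed real number $\mu=\mathbb{P}(X|H)$ (the conditional prevision), the conditional random quantity $X|H$ is $XH+\mu\overline{H}$ (value $X$ if $H$ is true, $\mu$ if $H$ is false). For a conditional event $E|H$ with $P(E|H)=x$, its indicator (same symbol) is $E|H=EH+x\overline{H}$; it is true, false or void when $EH$, $\overline{E}H$ or $\overline{H}$ is true, respectively. Coherence. A prevision assessment on a family of conditional random quantities is coherent if for every finite subfamily $X_1|H_1,\ldots,X_m|H_m$ with assessed previsions $\mu_1,\ldots,\mu_m$ and all real $s_1,\ldots,s_m$, the random gain $G=\sum_{i=1}^m s_iH_i(X_i-\mu_i)$, restricted to $H_1\vee\cdots\vee H_m$, satisfies $\min G\le 0\le\max G$. Conjunction. For a finite family $(A_i|K_i)_{i\in T}$ of conditional events, the conjunctions $\mathscr{C}_S=\bigwedge_{i\in S}(A_i|K_i)$, $\emptyset\ne S\subseteq T$, with assessed previsions $x_S=\mathbb{P}(\mathscr{C}_S)$, are defined recursively on $|S|$ by \[ \mathscr{C}_S=\Big[\bigwedge_{i\in S}A_iK_i+\sum_{\emptyset\neq R\subsetneq S}x_R\Big(\bigwedge_{i\in R}\overline{K}_i\Big)\wedge\Big(\bigwedge_{i\in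 S\setminus R}A_iK_i\Big)\Big]\Big|\Big(\bigvee_{i\in S}K_i\Big), \] i.e. $\mathscr{C}_S$ has value $1$ if all $A_iK_i$ ($i\in S$) are true; $0$ if some $\overline{A}_iK_i$ is true; $x_R$ if exactly the conditional events with index in $R$ are void and the others are true ($\emptyset\ne R\subsetneq S$); $x_S$ if all $K_i$, $i\in S$, are false. For $S=\{i\}$, $\mathscr{C}_S=A_i|K_i$. The conjunction of two conjunctions is the conjunction of the union of the two underlying families: $\mathscr{C}(\mathscr{E}')\wedge\mathscr{C}(\mathscr{E}'')=\mathscr{C}(\mathscr{E}'\cup\mathscr{E}'')$. In $1\wedge\mathscr{C}$ the symbol $1$ stands for a conditional event $E|H$ with $H\subseteq E$ (whose indicator is identically $1$), and $1\wedge\mathscr{C}=\mathscr{C}$. Index notation. A string of indices denotes the conjunction of the corresponding conditional events: $j$ stands for $E_j|H_j$ and $\overline{j}$ for $\overline{E}_j|H_j$; e.g. $\mathscr{C}_{j_1j_2}=(E_{j_1}|H_{j_1})\wedge(E_{j_2}|H_{j_2})$. Standing assumption. The previsions assessed for all conditional events $E_i|H_i$, $\overline{E}_i|H_i$ and all conjunctions of these involved form a coherent assessment. Equality of conditional random quantities means equality of values in all cases (as functions on $\Omega$). *)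

theory Defs
  imports Complex_Main "HOL-Library.Indicator_Function"
begin

text \<open>
  Events are subsets of the universe of an arbitrary type \<open>'w\<close>, which plays the role of the
  sure event; complement is negation.
\<close>

definition cond_rq :: "('w \<Rightarrow> real) \<Rightarrow> 'w set \<Rightarrow> real \<Rightarrow> 'w \<Rightarrow> real" where
  "cond_rq X H \<mu> \<omega> = X \<omega> * indicator H \<omega> + \<mu> * indicator (- H) \<omega>"

definition gain ::
  "('i \<Rightarrow> 'w \<Rightarrow> real) \<Rightarrow> ('i \<Rightarrow> 'w set) \<Rightarrow> ('i \<Rightarrow> real) \<Rightarrow> 'i set \<Rightarrow> ('i \<Rightarrow> real) \<Rightarrow> 'w \<Rightarrow> real" where
  "gain X H \<mu> F s \<omega> = (\<Sum>i\<in>F. s i * indicator (H i) \<omega> * (X i \<omega> - \<mu> i))"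

text \<open>
  Coherence of the assessment \<open>\<mu> i\<close> on the conditional random quantities \<open>X i | H i\<close>, \<open>i \<in> I\<close>.
  \<open>Min\<close> and \<open>Max\<close> are meaningful because every \<open>H i\<close> is meant to be nonempty and every \<open>X i\<close>
  to take finitely many values on \<open>H i\<close>; both hold for the conjunctions below as soon as
  the conditioning events are nonempty.
\<close>

definition coherent_assessment ::
  "'i set \<Rightarrow> ('i \<Rightarrow> 'w \<Rightarrow> real) \<Rightarrow> ('i \<Rightarrow> 'w set) \<Rightarrow> ('i \<Rightarrow> real) \<Rightarrow> bool" where
  "coherent_assessment I X H \<mu> \<longleftrightarrow>
     (\<forall>F s. F \<subseteq> I \<and> finite F \<and> F \<noteq> {} \<longrightarrow>
        Min (gain X H \<mu> F s ` (\<Union>i\<in>F. H i)) \<le> 0 \<and>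
        0 \<le> Max (gain X H \<mu> F s ` (\<Union>i\<in>F. H i)))"

text \<open>
  The conjunction of the conditional events \<open>A i | K i\<close>, \<open>i \<in> S\<close>, for finite nonempty \<open>S\<close>, where
  \<open>x R\<close> is the assessed prevision of the conjunction over \<open>R\<close>.  The conjunctions over smaller
  index sets enter only through these numbers, so no recursion is needed.
\<close>

definition conj_quantity ::
  "('i \<Rightarrow> 'w set) \<Rightarrow> ('i \<Rightarrow> 'w set) \<Rightarrow> ('i set \<Rightarrow> real) \<Rightarrow> 'i set \<Rightarrow> 'w \<Rightarrow> real" where
  "conj_quantity A K x S \<omega> =
     indicator (\<Inter>i\<in>S. A i \<inter> K i) \<omega> +
     (\<Sum>R | R \<noteq> {} \<and> R \<subset> S.
        x R * indicator ((\<Inter>i\<in>R. - K i) \<inter> (\<Inter>i\<in>S - R. A i \<inter> K i)) \<omega>)"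

definition conj_condition :: "('i \<Rightarrow> 'w set) \<Rightarrow> 'i set \<Rightarrow> 'w set" where
  "conj_condition K S = (\<Union>i\<in>S. K i)"

definition conjunction ::
  "('i \<Rightarrow> 'w set) \<Rightarrow> ('i \<Rightarrow> 'w set) \<Rightarrow> ('i set \<Rightarrow> real) \<Rightarrow> 'i set \<Rightarrow> 'w \<Rightarrow> real" where
  "conjunction A K x S = cond_rq (conj_quantity A K x S) (conj_condition K S) (x S)"

text \<open>
  \<open>Pos i\<close> indexes \<open>E i | H i\<close> and \<open>Neg i\<close> indexes \<open>- E i | H i\<close>.  A conjunction of such conditional
  events is given by its set of literals, and the conjunction of two conjunctions by the
  union of their sets of literals.
\<close>

datatype literal = Pos nat | Neg nat

fun lit_event :: "(nat \<Rightarrow> 'w set) \<Rightarrow> literal \<Rightarrow> 'w set" where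
  "lit_event E (Pos i) = E i"
| "lit_event E (Neg i) = - E i"

fun lit_condition :: "(nat \<Rightarrow> 'w set) \<Rightarrow> literal \<Rightarrow> 'w set" where
  "lit_condition H (Pos i) = H i"
| "lit_condition H (Neg i) = H i"

definition literal_sets :: "nat set \<Rightarrow> literal set set" where
  "literal_sets J =
     {S. S \<noteq> {} \<and> S \<subseteq> Pos ` J \<union> Neg ` J \<and> (\<forall>i\<in>J. \<not> (Pos i \<in> S \<and> Neg i \<in> S))}"

abbreviation lit_conjunction ::
  "(nat \<Rightarrow> 'w set) \<Rightarrow> (nat \<Rightarrow> 'w set) \<Rightarrow> (literal set \<Rightarrow> real) \<Rightarrow> literal set \<Rightarrow> 'w \<Rightarrow> real" where
  "lit_conjunction E H \<equiv> conjunction (lit_event E) (lit_condition H)"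

text \<open>
  Conjunctions containing both \<open>Pos i\<close> and \<open>Neg i\<close> are not required to be assessed; this is the
  weaker requirement, since every subfamily of a coherent family is coherent.
\<close>

definition coherent_conjunctions ::
  "nat set \<Rightarrow> (nat \<Rightarrow> 'w set) \<Rightarrow> (nat \<Rightarrow> 'w set) \<Rightarrow> (literal set \<Rightarrow> real) \<Rightarrow> bool" where
  "coherent_conjunctions J E H x \<longleftrightarrow>
     coherent_assessment (literal_sets J)
       (conj_quantity (lit_event E) (lit_condition H) x)
       (conj_condition (lit_condition H)) x"

end

theory Submission
  imports Defs
begin

text \<open>
  Everything rests on one identity for a single negation: if a set \<open>S\<close> of literals does not
  mention \<open>i\<close>, then \<open>S \<union> {Neg i}\<close> and \<open>S \<union> {Pos i}\<close> have conjunctions that add up to the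
  conjunction of \<open>S\<close> (\<open>lit_conjunction_negation\<close>).  The alternating sums are then
  inclusion-exclusion, obtained by removing the negated literals one at a time
  (\<open>lit_conjunction_inclusion_exclusion\<close>), and the two equalities of the theorem are the cases
  of an empty and of a nonempty set of additional positive literals.

  The identity for one negation is clear in every case in which \<open>E i | H i\<close> is not void: one of the
  two summands is then \<open>0\<close> and the other one ignores \<open>i\<close>.  If \<open>E i | H i\<close> is void and \<open>V\<close> is the set
  of void members of \<open>S\<close>, the identity reduces to \<open>x (V \<union> {Neg i}) + x (V \<union> {Pos i}) = x V\<close>, a
  relation between assessed numbers, and only here coherence is used
  (\<open>prevision_negation\<close>).  The relation is proved by induction on the set: if it holds for
  all proper subsets of \<open>S\<close>, then the identity of conjunctions holds at every point where not all of
  \<open>S \<union> {Pos i}\<close> is void, so that betting on both summands and against \<open>S\<close> has a constant gain,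
  which coherence forces to be \<open>0\<close>.

  All of this becomes uniform once the empty conjunction is the constant \<open>1\<close>.  Setting
  \<open>x {}\<close> to \<open>1\<close> achieves this, and it changes neither the coherence of the assessment nor any
  nonempty conjunction.
\<close>

section \<open>Values of a conjunction\<close>

text \<open>
  With \<open>x {} = 1\<close> the four cases in the definition of a conjunction collapse to two: a false
  conjunct gives \<open>0\<close>, and otherwise the value is the prevision of the void part, which is empty if
  all conjuncts are true and the whole of \<open>S\<close> if all are void.
\<close>

lemma conjunction_value:
  assumes "finite S" and x1: "x {} = 1"
  shows "conjunction A K x S \<omega> =
    (if \<exists>i\<in>S. \<omega> \<in> K i - A i then 0 else x {i\<in>S. \<omega> \<notin> K i})"
proof -
  define V where "V = {i\<in>S. \<omega> \<notin> K i}"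
  define false where "false \<longleftrightarrow> (\<exists>i\<in>S. \<omega> \<in> K i - A i)"
  have void_part: "\<omega> \<in> (\<Inter>i\<in>R. - K i) \<inter> (\<Inter>i\<in>S - R. A i \<inter> K i) \<longleftrightarrow> \<not> false \<and> R = V"
    if "R \<subseteq> S" for R
    using that unfolding V_def false_def by blast
  have true_part: "\<omega> \<in> (\<Inter>i\<in>S. A i \<inter> K i) \<longleftrightarrow> \<not> false \<and> V = {}"
    unfolding V_def false_def by blast
  have "(\<Sum>R | R \<noteq> {} \<and> R \<subset> S.
        x R * indicator ((\<Inter>i\<in>R. - K i) \<inter> (\<Inter>i\<in>S - R. A i \<inter> K i)) \<omega>)
      = (\<Sum>R | R \<noteq> {} \<and> R \<subset> S. if R = V then (if false then 0 else x V) else 0)"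
    by (rule sum.cong) (simp_all add: indicator_def void_part psubset_imp_subset del: Int_iff INT_iff)
  also have "\<dots> = (if V \<noteq> {} \<and> V \<subset> S \<and> \<not> false then x V else 0)"
    using finite_subset[of "{R. R \<noteq> {} \<and> R \<subset> S}" "Pow S"] assms(1)
    by (subst sum.delta) auto
  finally have quantity: "conj_quantity A K x S \<omega> =
      (if false then 0 else if V = {} then 1 else if V \<subset> S then x V else 0)"
    unfolding conj_quantity_def using true_part by (auto simp: indicator_def)
  have condition: "\<omega> \<in> conj_condition K S \<longleftrightarrow> V \<noteq> S"
    unfolding conj_condition_def V_def by blast
  have "V \<subseteq> S" "V = S \<Longrightarrow> \<not> false"
    unfolding V_def false_def by auto
  then show ?thesis
    unfolding conjunction_def cond_rq_def quantity V_def[symmetric] false_def[symmetric]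
    using condition x1 by (auto simp: indicator_def)
qed

lemma conj_quantity_empty_prevision: "conj_quantity A K (x({} := c)) S = conj_quantity A K x S"
  unfolding conj_quantity_def by (intro ext arg_cong2[where f = "(+)"] sum.cong) auto

lemma conjunction_empty_prevision:
  "S \<noteq> {} \<Longrightarrow> conjunction A K (x({} := c)) S = conjunction A K x S"
  by (simp add: conjunction_def conj_quantity_empty_prevision)

lemma coherent_conjunctions_empty_prevision:
  assumes "coherent_conjunctions J E H x"
  shows "coherent_conjunctions J E H (x({} := c))"
proof -
  have "gain Q C (x({} := c)) F s = gain Q C x F s"
    if "F \<subseteq> literal_sets J" for Q :: "literal set \<Rightarrow> 'a \<Rightarrow> real" and C F s
    unfolding gain_def using that by (intro ext sum.cong) (auto simp: literal_sets_def)
  moreover have "conj_quantity (lit_event E) (lit_condition H) (x({} := c))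
      = conj_quantity (lit_event E) (lit_condition H) x"
    by (rule ext) (rule conj_quantity_empty_prevision)
  ultimately show ?thesis
    using assms unfolding coherent_conjunctions_def coherent_assessment_def by simp
qed

section \<open>Gains\<close>

text \<open>
  A bet on \<open>X | H\<close> that is called off outside \<open>H\<close> wins the amount by which the
  conditional random quantity exceeds its prevision.
\<close>

lemma gain_eq_sum_cond_rq:
  "gain X H \<mu> F s \<omega> = (\<Sum>i\<in>F. s i * (cond_rq (X i) (H i) (\<mu> i) \<omega> - \<mu> i))"
  unfolding gain_def cond_rq_def by (rule sum.cong) (auto simp: indicator_def)

lemma coherent_constant_gain:
  assumes "coherent_assessment I X H \<mu>" and "F \<subseteq> I" "finite F"
    and nonempty: "(\<Union>i\<in>F. H i) \<noteq> {}"
    and const: "\<And>\<omega>. \<omega> \<in> (\<Union>i\<in>F. H i) \<Longrightarrow> gain X H \<mu> F s \<omega> = c"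
  shows "c = 0"
proof -
  have "gain X H \<mu> F s ` (\<Union>i\<in>F. H i) = {c}"
    using nonempty const by (metis image_cong image_constant_conv)
  moreover have "F \<noteq> {}"
    using nonempty by auto
  ultimately show ?thesis
    using assms(1-3) unfolding coherent_assessment_def
    by (metis Max_singleton Min_singleton order_antisym)
qed

section \<open>Negating one literal\<close>

text \<open>
  When \<open>E i | H i\<close> is void, the three conjunctions take the previsions of their void parts as
  values (or all vanish), whence the hypothesis on \<open>x\<close>; in the other cases the identity is a
  matter of evaluation.
\<close>

lemma lit_conjunction_negation_at:
  assumes "finite S" and "x {} = 1"
    and "\<omega> \<notin> H i \<Longrightarrow> x (insert (Neg i) {l\<in>S. \<omega> \<notin> lit_condition H l})
      + x (insert (Pos i) {l\<in>S. \<omega> \<notin> lit_condition H l}) = x {l\<in>S. \<omega> \<notin> lit_condition H l}"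
  shows "lit_conjunction E H x (insert (Neg i) S) \<omega> + lit_conjunction E H x (insert (Pos i) S) \<omega>
    = lit_conjunction E H x S \<omega>"
proof -
  have "{l \<in> insert k S. \<omega> \<notin> lit_condition H l} =
      (if \<omega> \<in> lit_condition H k then {l\<in>S. \<omega> \<notin> lit_condition H l}
       else insert k {l\<in>S. \<omega> \<notin> lit_condition H l})" for k
    by auto
  with assms show ?thesis
    by (auto simp: conjunction_value)
qed

lemma literal_sets_insert:
  assumes "S \<in> insert {} (literal_sets J)" "i \<in> J" "Pos i \<notin> S" "Neg i \<notin> S"
  shows "insert (Pos i) S \<in> literal_sets J" "insert (Neg i) S \<in> literal_sets J"
  using assms by (auto simp: literal_sets_def)

lemma literal_sets_subset:
  "S \<in> insert {} (literal_sets J) \<Longrightarrow> V \<subseteq> S \<Longrightarrow> V \<in> insert {} (literal_sets J)"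
  unfolding literal_sets_def by blast

text \<open>
  Buying the two conjunctions that contain \<open>i\<close> and selling that of \<open>S\<close> must have gain \<open>0\<close>.  The
  induction makes the gain constant: for proper subsets the relation says that the three
  quantities cancel wherever some conjunct of \<open>S\<close> is not void.
\<close>

lemma prevision_negation:
  assumes coh: "coherent_conjunctions J E H x" and x1: "x {} = 1"
    and i: "i \<in> J" "H i \<noteq> {}"
    and "finite S" "S \<in> insert {} (literal_sets J)" "Pos i \<notin> S" "Neg i \<notin> S"
  shows "x (insert (Neg i) S) + x (insert (Pos i) S) = x S"
  using assms(5-)
proof (induction S rule: finite_psubset_induct)
  case (psubset S)
  let ?N = "insert (Neg i) S" and ?P = "insert (Pos i) S"
  let ?C = "lit_conjunction E H x"
  let ?K = "conj_condition (lit_condition H)"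
  \<comment> \<open>The empty conjunction is no member of the assessed family, but a bet on it has gain \<open>0\<close>.\<close>
  define F where "F = {?N, ?P, S} - {{}}"
  define s :: "literal set \<Rightarrow> real" where "s T = (if T = S then - 1 else 1)" for T
  have distinct: "?N \<noteq> ?P" "?N \<noteq> S" "?P \<noteq> S"
    using psubset.prems by auto
  have union: "(\<Union>T\<in>F. ?K T) = H i \<union> ?K S"
    by (cases "S = {}") (simp_all add: F_def conj_condition_def insert_Diff_if Un_absorb1 Un_ac)
  have cancel: "?C ?N \<omega> + ?C ?P \<omega> = ?C S \<omega>" if \<omega>: "\<omega> \<in> H i \<union> ?K S" for \<omega>
  proof (rule lit_conjunction_negation_at[OF psubset.hyps, of x, OF x1])
    let ?V = "{l\<in>S. \<omega> \<notin> lit_condition H l}"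
    assume "\<omega> \<notin> H i"
    with \<omega> have "?V \<subset> S"
      unfolding conj_condition_def by auto
    then show "x (insert (Neg i) ?V) + x (insert (Pos i) ?V) = x ?V"
      using psubset.prems literal_sets_subset[of S J ?V] by (intro psubset.IH) auto
  qed
  have "x S - x ?N - x ?P = 0"
  proof (rule coherent_constant_gain)
    show "coherent_assessment (literal_sets J)
        (conj_quantity (lit_event E) (lit_condition H) x) ?K x"
      using coh unfolding coherent_conjunctions_def .
    show "F \<subseteq> literal_sets J"
      unfolding F_def using literal_sets_insert[of S J i] psubset.prems i by auto
    show "finite F"
      unfolding F_def by simp
    show "(\<Union>T\<in>F. ?K T) \<noteq> {}"
      using union i by auto
    fix \<omega> assume \<omega>: "\<omega> \<in> (\<Union>T\<in>F. ?K T)"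
    have "gain (conj_quantity (lit_event E) (lit_condition H) x) ?K x F s \<omega>
        = (\<Sum>T\<in>F. s T * (?C T \<omega> - x T))"
      unfolding gain_eq_sum_cond_rq conjunction_def ..
    also have "\<dots> = (\<Sum>T\<in>{?N, ?P, S}. s T * (?C T \<omega> - x T))"
      unfolding F_def by (rule sum.mono_neutral_left) (auto simp: conjunction_value x1)
    also have "\<dots> = x S - x ?N - x ?P"
      using distinct cancel[of \<omega>] \<omega> union by (simp add: s_def)
    finally show "gain (conj_quantity (lit_event E) (lit_condition H) x) ?K x F s \<omega>
        = x S - x ?N - x ?P" .
  qed
  then show ?case by simp
qed

lemma lit_conjunction_negation:
  assumes "coherent_conjunctions J E H x" and "x {} = 1"
    and "i \<in> J" "H i \<noteq> {}"
    and "finite S" "S \<in> insert {} (literal_sets J)" "Pos i \<notin> S" "Neg i \<notin> S"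
  shows "lit_conjunction E H x (insert (Neg i) S) \<omega>
    = lit_conjunction E H x S \<omega> - lit_conjunction E H x (insert (Pos i) S) \<omega>"
proof -
  let ?V = "{l\<in>S. \<omega> \<notin> lit_condition H l}"
  have "x (insert (Neg i) ?V) + x (insert (Pos i) ?V) = x ?V"
    using assms literal_sets_subset[of S J ?V] by (intro prevision_negation[of J E H]) auto
  then show ?thesis
    using lit_conjunction_negation_at[of S x \<omega> H i E] assms by simp
qed

section \<open>Inclusion-exclusion\<close>

text \<open>
  Trading \<open>Neg a\<close> for the difference of \<open>T\<close> and \<open>T \<union> {Pos a}\<close> moves a literal into \<open>T\<close>, so the
  induction on \<open>A\<close> is over all \<open>T\<close>; the subsets of \<open>A \<union> {a}\<close> without and with \<open>a\<close> come from the two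
  terms of the difference.
\<close>

lemma lit_conjunction_inclusion_exclusion:
  assumes coh: "coherent_conjunctions J E H x" and x1: "x {} = 1"
    and nonempty: "\<And>i. i \<in> J \<Longrightarrow> H i \<noteq> {}"
    and "finite A" "A \<subseteq> J" "finite T" "T \<in> insert {} (literal_sets J)"
    and "\<And>i. i \<in> A \<Longrightarrow> Pos i \<notin> T \<and> Neg i \<notin> T"
  shows "lit_conjunction E H x (Neg ` A \<union> T) \<omega>
    = (\<Sum>B\<in>Pow A. (-1) ^ card B * lit_conjunction E H x (Pos ` B \<union> T) \<omega>)"
  using assms(4-)
proof (induction A arbitrary: T rule: finite_induct)
  case empty
  then show ?case by simp
next
  case (insert a A)
  let ?C = "\<lambda>S. lit_conjunction E H x S \<omega>"
  have a: "a \<in> J" "H a \<noteq> {}" "Pos a \<notin> T" "Neg a \<notin> T"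
    using insert.prems nonempty by auto
  have consistent: "Neg ` A \<union> T \<in> insert {} (literal_sets J)"
    using insert.prems by (auto simp: literal_sets_def)
  have "?C (Neg ` insert a A \<union> T) = ?C (Neg ` A \<union> T) - ?C (Neg ` A \<union> insert (Pos a) T)"
    using lit_conjunction_negation[OF coh x1 a(1,2) _ consistent] insert.prems insert.hyps a
    by auto
  also have "?C (Neg ` A \<union> T) = (\<Sum>B\<in>Pow A. (-1) ^ card B * ?C (Pos ` B \<union> T))"
    using insert.prems by (intro insert.IH) auto
  also have "?C (Neg ` A \<union> insert (Pos a) T)
      = (\<Sum>B\<in>Pow A. (-1) ^ card B * ?C (Pos ` B \<union> insert (Pos a) T))"
    using insert.prems insert.hyps literal_sets_insert[of T J a] a by (intro insert.IH) auto
  also have "(\<Sum>B\<in>Pow A. (-1) ^ card B * ?C (Pos ` B \<union> insert (Pos a) T))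
      = - (\<Sum>B\<in>Pow A. (-1) ^ card (insert a B) * ?C (Pos ` insert a B \<union> T))"
    unfolding sum_negf[symmetric]
  proof (rule sum.cong)
    fix B assume "B \<in> Pow A"
    then have "card (insert a B) = Suc (card B)"
      using insert.hyps by (intro card_insert_disjoint) (auto intro: finite_subset)
    then show "(-1) ^ card B * ?C (Pos ` B \<union> insert (Pos a) T)
        = - ((-1) ^ card (insert a B) * ?C (Pos ` insert a B \<union> T))"
      by simp
  qed simp
  also have "(\<Sum>B\<in>Pow A. (-1) ^ card (insert a B) * ?C (Pos ` insert a B \<union> T))
      = (\<Sum>B\<in>insert a ` Pow A. (-1) ^ card B * ?C (Pos ` B \<union> T))"
    using insert.hyps by (subst sum.reindex) (auto simp: inj_on_def)
  also have "(\<Sum>B\<in>Pow A. (-1) ^ card B * ?C (Pos ` B \<union> T))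
      - - (\<Sum>B\<in>insert a ` Pow A. (-1) ^ card B * ?C (Pos ` B \<union> T))
      = (\<Sum>B\<in>Pow (insert a A). (-1) ^ card B * ?C (Pos ` B \<union> T))"
    unfolding Pow_insert
    using insert.hyps by (subst sum.union_disjoint) auto
  finally show ?case .
qed

lemma sum_Pow_by_card:
  fixes f :: "nat set \<Rightarrow> real"
  shows "(\<Sum>B\<in>Pow {1..h}. (-1) ^ card B * f B)
    = f {} + (\<Sum>r=1..h. (-1) ^ r * (\<Sum>B | B \<subseteq> {1..h} \<and> card B = r. f B))"
proof -
  have "card B \<le> h" if "B \<subseteq> {1..h}" for B
    using card_mono[OF _ that] by simp
  then have "(\<Sum>B\<in>Pow {1..h}. (-1) ^ card B * f B)
      = (\<Sum>r\<in>{0..h}. \<Sum>B | B \<in> Pow {1..h} \<and> card B = r. (-1) ^ card B * f B)"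
    by (intro sum.group[symmetric]) auto
  also have "\<dots> = (\<Sum>r=0..h. (-1) ^ r * (\<Sum>B | B \<subseteq> {1..h} \<and> card B = r. f B))"
    by (simp add: sum_distrib_left)
  also have "\<dots> = (\<Sum>B | B \<subseteq> {1..h} \<and> card B = 0. f B)
      + (\<Sum>r=1..h. (-1) ^ r * (\<Sum>B | B \<subseteq> {1..h} \<and> card B = r. f B))"
    by (simp add: sum.atLeast_Suc_atMost)
  also have "{B. B \<subseteq> {1..h} \<and> card B = 0} = {{}}"
    by (auto dest: finite_subset)
  finally show ?thesis by simp
qed

text \<open>
  In the first equality the leading \<open>1\<close> is the empty conjunction for the modified assessment
  \<open>y\<close>; every other conjunction in the statement is nonempty and hence the same for \<open>x\<close> and \<open>y\<close>.
\<close>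

theorem theorem13:
  fixes E H :: "nat \<Rightarrow> 'w set" and x :: "literal set \<Rightarrow> real"
    and n h :: nat and I :: "nat set"
  assumes "1 \<le> n"
    and "\<And>i. i \<in> {1..n+1} \<Longrightarrow> H i \<noteq> {}"
    and "coherent_conjunctions {1..n+1} E H x"
    and "1 \<le> h" and "h \<le> n"
    and "I \<subseteq> {h+1..n}"
  shows "(\<lambda>\<omega>. 1 + (\<Sum>r=1..h. (-1) ^ r *
             (\<Sum>J | J \<subseteq> {1..h} \<and> card J = r. lit_conjunction E H x (Pos ` J) \<omega>)))
         = lit_conjunction E H x (Neg ` {1..h})
       \<and> lit_conjunction E H x (Neg ` {1..h} \<union> Pos ` (I \<union> {n+1}))
         = (\<lambda>\<omega>. lit_conjunction E H x (Pos ` (I \<union> {n+1})) \<omega> + (\<Sum>r=1..h. (-1) ^ r *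
             (\<Sum>J | J \<subseteq> {1..h} \<and> card J = r.
                lit_conjunction E H x (Pos ` J \<union> Pos ` (I \<union> {n+1})) \<omega>)))"
proof -
  define y where "y = x({} := 1)"
  have y1: "y {} = 1"
    unfolding y_def by simp
  have same: "lit_conjunction E H y S = lit_conjunction E H x S" if "S \<noteq> {}" for S
    unfolding y_def by (rule conjunction_empty_prevision[OF that])
  have coh: "coherent_conjunctions {1..n+1} E H y"
    unfolding y_def by (rule coherent_conjunctions_empty_prevision[OF assms(3)])
  have expansion: "lit_conjunction E H y (Neg ` {1..h} \<union> T) \<omega>
      = lit_conjunction E H y T \<omega> + (\<Sum>r=1..h. (-1) ^ r *
          (\<Sum>J | J \<subseteq> {1..h} \<and> card J = r. lit_conjunction E H y (Pos ` J \<union> T) \<omega>))"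
    if "finite T" "T \<in> insert {} (literal_sets {1..n+1})"
      and "\<And>i. i \<in> {1..h} \<Longrightarrow> Pos i \<notin> T \<and> Neg i \<notin> T" for T \<omega>
    using lit_conjunction_inclusion_exclusion[OF coh y1 assms(2), of "{1..h}" T \<omega>] that \<open>h \<le> n\<close>
      sum_Pow_by_card[of "\<lambda>B. lit_conjunction E H y (Pos ` B \<union> T) \<omega>" h]
    by simp
  have "(\<lambda>\<omega>. 1 + (\<Sum>r=1..h. (-1) ^ r *
             (\<Sum>J | J \<subseteq> {1..h} \<and> card J = r. lit_conjunction E H x (Pos ` J) \<omega>)))
         = lit_conjunction E H x (Neg ` {1..h})"
  proof
    fix \<omega>
    have "lit_conjunction E H y {} \<omega> = 1"
      by (simp add: conjunction_value y1)
    moreover have "(\<Sum>r=1..h. (-1) ^ r *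
          (\<Sum>J | J \<subseteq> {1..h} \<and> card J = r. lit_conjunction E H y (Pos ` J) \<omega>))
        = (\<Sum>r=1..h. (-1) ^ r *
          (\<Sum>J | J \<subseteq> {1..h} \<and> card J = r. lit_conjunction E H x (Pos ` J) \<omega>))"
      by (intro sum.cong refl arg_cong2[where f = "(*)"] fun_cong[OF same]) auto
    ultimately show "1 + (\<Sum>r=1..h. (-1) ^ r *
             (\<Sum>J | J \<subseteq> {1..h} \<and> card J = r. lit_conjunction E H x (Pos ` J) \<omega>))
         = lit_conjunction E H x (Neg ` {1..h}) \<omega>"
      using expansion[of "{}" \<omega>] same[of "Neg ` {1..h}"] \<open>1 \<le> h\<close> by simp
  qed
  moreover have "lit_conjunction E H x (Neg ` {1..h} \<union> Pos ` (I \<union> {n+1})) \<omega>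
      = lit_conjunction E H x (Pos ` (I \<union> {n+1})) \<omega> + (\<Sum>r=1..h. (-1) ^ r *
             (\<Sum>J | J \<subseteq> {1..h} \<and> card J = r.
                lit_conjunction E H x (Pos ` J \<union> Pos ` (I \<union> {n+1})) \<omega>))" for \<omega>
  proof -
    let ?T = "Pos ` (I \<union> {n+1})"
    have "finite ?T"
      using finite_subset[OF assms(6)] by simp
    moreover have "?T \<in> insert {} (literal_sets {1..n+1})"
      using assms(6) by (fastforce simp: literal_sets_def)
    moreover have "Pos i \<notin> ?T \<and> Neg i \<notin> ?T" if "i \<in> {1..h}" for i
      using that assms(5,6) by auto
    ultimately show ?thesis
      using expansion[of ?T \<omega>] by (simp add: same)
  qed
  ultimately show ?thesis by blast
qed

end
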